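(* Let $G$ be a simple graph on $n$ vertices, let $\Sigma\subseteq E(G)$ be a signature, and let $\Sigma'$ be a minimal signature equivalent to $\Sigma$. Then for every vertex $v$ of $G$, the number of edges of $\Sigma'$ incident with $v$ is at most $\lfloor \frac{n-1}{2}\rfloor$.
   Context: A signature of a graph $G$ is a set $\Sigma\subseteq E(G)$ of edges (the negative edges). Resigning (switching) at a vertex $v$ replaces $\Sigma$ by its symmetric difference with the set of edges incident with $v$. Two signatures are (switching) equivalent if one is obtained from the other by a sequence of resignings. A minimal signature equivalent to $\Sigma$ is a signature equivalent to $\Sigma$ with the minimum number of edges among all signatures equivalent to $\Sigma$. *)

theory Defs
  imports Complex_Main
begin

definition simple_graph :: "'a set \<Rightarrow> 'a set set \<Rightarrow> bool" where
  "simple_graph V E \<longleftrightarrow> finite V \<and> (\<forall>e\<in>E. e \<subseteq> V \<and> card e = 2)"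

definition signature :: "'a set set \<Rightarrow> 'a set set \<Rightarrow> bool" where
  "signature E S \<longleftrightarrow> S \<subseteq> E"

definition incident_edges :: "'a set set \<Rightarrow> 'a \<Rightarrow> 'a set set" where
  "incident_edges F v = {e \<in> F. v \<in> e}"

definition resign :: "'a set set \<Rightarrow> 'a \<Rightarrow> 'a set set \<Rightarrow> 'a set set" where
  "resign E v S = (S - incident_edges E v) \<union> (incident_edges E v - S)"

definition switching_equivalent ::
    "'a set \<Rightarrow> 'a set set \<Rightarrow> 'a set set \<Rightarrow> 'a set set \<Rightarrow> bool" where
  "switching_equivalent V E = (\<lambda>S T. \<exists>v\<in>V. T = resign E v S)\<^sup>*\<^sup>*"

definition minimal_signature ::
    "'a set \<Rightarrow> 'a set set \<Rightarrow> 'a set set \<Rightarrow> 'a set set \<Rightarrow> bool" where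
  "minimal_signature V E S S' \<longleftrightarrow>
     is_arg_min card (\<lambda>T. signature E T \<and> switching_equivalent V E S T) S'"

end

theory Submission
  imports Defs
begin

text \<open>Resigning at \<open>v\<close> exchanges the negative and positive edges at
  \<open>v\<close> and leaves all other edges alone. If more than half of the edges at
  \<open>v\<close> were negative in \<open>S'\<close>, this single switch would give a smaller
  equivalent signature. So minimality forces at most half of the edges at \<open>v\<close> to be
  negative (\<open>card_resign\<close> does the count), and a simple graph has at most n - 1 edges
  at \<open>v\<close> (\<open>card_incident_edges_less\<close>).\<close>

lemma simple_graph_finite_edges:
  assumes "simple_graph V E"
  shows "finite E"
proof (rule finite_subset)
  show "E \<subseteq> Pow V" "finite (Pow V)"
    using assms by (auto simp: simple_graph_def)
qed

text \<open>An edge at \<open>v\<close> is determined by its other endpoint, which lies in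
  \<open>V - {v}\<close>.\<close>

lemma card_incident_edges_less:
  assumes "simple_graph V E" "v \<in> V"
  shows "card (incident_edges E v) < card V"
proof -
  have fin: "finite V" and E: "\<And>e. e \<in> E \<Longrightarrow> e \<subseteq> V \<and> card e = 2"
    using assms by (auto simp: simple_graph_def)
  have "incident_edges E v \<subseteq> (\<lambda>u. {v, u}) ` (V - {v})"
  proof
    fix e assume "e \<in> incident_edges E v"
    then have e: "v \<in> e" "e \<subseteq> V" "card e = 2"
      using E by (auto simp: incident_edges_def)
    then obtain x y where "e = {x, y}" "x \<noteq> y"
      by (auto simp: card_2_iff)
    with e show "e \<in> (\<lambda>u. {v, u}) ` (V - {v})"
      by auto
  qed
  then have "card (incident_edges E v) \<le> card (V - {v})"
    using fin by (meson surj_card_le finite_Diff)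
  also have "\<dots> < card V"
    using fin assms(2) by (rule card_Diff1_less)
  finally show ?thesis .
qed

text \<open>Switching drops the negative edges at \<open>v\<close> and gains the positive ones,
  which number \<open>card (incident_edges E v) - card (incident_edges S v)\<close>. The additive
  form avoids truncated subtraction on naturals.\<close>

lemma card_resign:
  assumes "finite E" "S \<subseteq> E"
  shows "card (resign E v S) + 2 * card (incident_edges S v) = card S + card (incident_edges E v)"
proof -
  let ?I = "incident_edges E v" and ?J = "incident_edges S v"
  have sub: "?J \<subseteq> S" "?J \<subseteq> ?I" "S - ?I = S - ?J" "?I - S = ?I - ?J"
    using assms(2) by (auto simp: incident_edges_def)
  have fin: "finite S" "finite ?I"
    using assms by (auto simp: incident_edges_def intro: finite_subset)
  have "card (resign E v S) = card (S - ?I) + card (?I - S)"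
    unfolding resign_def using fin by (intro card_Un_disjoint) auto
  moreover have "card (S - ?I) + card ?J = card S" "card (?I - S) + card ?J = card ?I"
    using sub fin by (metis card_Diff_subset card_mono finite_subset le_add_diff_inverse2)+
  ultimately show ?thesis
    by simp
qed

theorem theorem2:
  fixes V :: "'a set" and E S S' :: "'a set set" and n :: nat
  assumes "simple_graph V E"
    and "card V = n"
    and "signature E S"
    and "minimal_signature V E S S'"
  shows "\<forall>v\<in>V. int (card (incident_edges S' v)) \<le> \<lfloor>(real n - 1) / 2\<rfloor>"
proof
  fix v assume v: "v \<in> V"
  have S': "S' \<subseteq> E" "switching_equivalent V E S S'"
    and least: "\<And>T. T \<subseteq> E \<Longrightarrow> switching_equivalent V E S T \<Longrightarrow> card S' \<le> card T"
    using assms(4) by (auto simp: minimal_signature_def is_arg_min_linorder signature_def)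
  \<comment> \<open>One further resigning stays in the switching class of \<open>S\<close>, so
    \<open>resign E v S'\<close> competes with \<open>S'\<close>.\<close>
  have "resign E v S' \<subseteq> E"
    using S'(1) by (auto simp: resign_def incident_edges_def)
  moreover have "switching_equivalent V E S (resign E v S')"
    using S'(2) v unfolding switching_equivalent_def
    by (auto intro: rtranclp.rtrancl_into_rtrancl)
  ultimately have "card S' \<le> card (resign E v S')"
    by (rule least)
  with card_resign[OF simple_graph_finite_edges[OF assms(1)] S'(1), of v]
  have "2 * card (incident_edges S' v) \<le> card (incident_edges E v)"
    by linarith
  with card_incident_edges_less[OF assms(1) v] assms(2)
  have "2 * card (incident_edges S' v) + 1 \<le> n"
    by linarith
  \<comment> \<open>The left side is an integer, so the floor can be removed; the strict degree
    bound supplied the 1.\<close>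
  then show "int (card (incident_edges S' v)) \<le> \<lfloor>(real n - 1) / 2\<rfloor>"
    by (simp add: le_floor_iff)
qed

end
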